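(* Let $(S,\cdot)$ be a semigroup which admits a left Følner sequence and a right Følner sequence, and let $A,B\subseteq S$ with $d_R^*(A)>0$ and $d_L^*(B)>0$. Then the set $AB^{-1}:=\{s\in S:\exists b\in B,\ sb\in A\}$ is (right) piecewise syndetic, i.e. there exists a finite set $K\subseteq S$ such that for every finite set $F\subseteq S$ there is some $t\in S$ with $tF\subseteq (AB^{-1})K^{-1}$, where for $P\subseteq S$ we write $PK^{-1}:=\{s\in S:\exists k\in K,\ sk\in P\}$.
   Context: A sequence $(F_n)_{n\in\mathbb{N}}$ of nonempty finite subsets of a semigroup $S$ is a left Følner sequence if $\lim_{n\to\infty}|(sF_n)\,\Delta\, F_n|/|F_n|=0$ for all $s\in S$, and a right Følner sequence if $\lim_{n\to\infty}|(F_ns)\,\Delta\, F_n|/|F_n|=0$ for all $s\in S$. The left upper Banach density of $C\subseteq S$ is $d_L^*(C):=\sup\{\limsup_{n\to\infty}|C\cap F_n|/|F_n| : (F_n) \text{ a left Følner sequence in } S\}$, and the right upper Banach density $d_R^*(C)$ is defined in the same way using right Følner sequences. (These are the analogues of the upper Banach density $\limsup_{m-n\to\infty}\frac{1}{m-n+1}|C\cap\{n,\dots,m\}|$ on $\mathbb{Z}$, with Følner sequences in place of intervals.) *)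

theory Defs
  imports "HOL-Library.Extended_Real"
begin

definition left_Folner :: "(nat \<Rightarrow> 'a::semigroup_mult set) \<Rightarrow> bool" where
  "left_Folner F \<longleftrightarrow>
     (\<forall>n. finite (F n) \<and> F n \<noteq> {}) \<and>
     (\<forall>s. (\<lambda>n. real (card (sym_diff ((\<lambda>x. s * x) ` F n) (F n))) / real (card (F n))) \<longlonglongrightarrow> 0)"

definition right_Folner :: "(nat \<Rightarrow> 'a::semigroup_mult set) \<Rightarrow> bool" where
  "right_Folner F \<longleftrightarrow>
     (\<forall>n. finite (F n) \<and> F n \<noteq> {}) \<and>
     (\<forall>s. (\<lambda>n. real (card (sym_diff ((\<lambda>x. x * s) ` F n) (F n))) / real (card (F n))) \<longlonglongrightarrow> 0)"

(* The densities are extended reals so that limsup and Sup are those of a complete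
   lattice.  They lie in [0, 1] as soon as a Folner sequence of the relevant kind
   exists; otherwise the supremum is over the empty set and equals -\<infinity>. *)

definition left_upper_Banach_density :: "'a::semigroup_mult set \<Rightarrow> ereal" where
  "left_upper_Banach_density C =
     Sup {limsup (\<lambda>n. ereal (real (card (C \<inter> F n)) / real (card (F n)))) | F. left_Folner F}"

definition right_upper_Banach_density :: "'a::semigroup_mult set \<Rightarrow> ereal" where
  "right_upper_Banach_density C =
     Sup {limsup (\<lambda>n. ereal (real (card (C \<inter> F n)) / real (card (F n)))) | F. right_Folner F}"

(* The set written P Q^{-1}; no inverses are assumed to exist in the semigroup. *)
definition right_quotient :: "'a::semigroup_mult set \<Rightarrow> 'a set \<Rightarrow> 'a set" where
  "right_quotient P Q = {s. \<exists>q\<in>Q. s * q \<in> P}"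

definition right_piecewise_syndetic :: "'a::semigroup_mult set \<Rightarrow> bool" where
  "right_piecewise_syndetic P \<longleftrightarrow>
     (\<exists>K. finite K \<and>
        (\<forall>F. finite F \<longrightarrow> (\<exists>t. (\<lambda>x. t * x) ` F \<subseteq> right_quotient P K)))"

end

theory Submission imports Defs
begin

text \<open>
  Suppose \<open>A B\<inverse>\<close> is not piecewise syndetic: every finite \<open>K\<close> has a finite
  \<open>\<Phi> K\<close> such that for all \<open>t\<close> some \<open>f \<in> \<Phi> K\<close> satisfies
  \<open>t f K B \<inter> A = {}\<close>. Iterate this from a single point \<open>a\<close>, with
  \<open>K\<^sub>j\<^sub>+\<^sub>1 = {a} \<union> a (\<Phi> K\<^sub>j) K\<^sub>j\<close>. Averaging over a right
  almost invariant set in which \<open>A\<close> is dense, one finds \<open>t\<close> such that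
  \<open>C = {x \<in> B \<inter> G. t x \<in> A}\<close> has at least \<open>\<gamma> |G|\<close> elements, where
  \<open>\<gamma> > 0\<close> is fixed in advance and \<open>G\<close> is a finite set as left invariant
  as desired. The elements \<open>f\<^sub>j \<in> \<Phi> K\<^sub>j\<close> belonging to this one \<open>t\<close>
  satisfy \<open>f\<^sub>j K\<^sub>j B \<inter> C = {}\<close>. Hence the sets \<open>V\<^sub>0 = {}\<close>,
  \<open>V\<^sub>j\<^sub>+\<^sub>1 = f\<^sub>j a (V\<^sub>j \<union> C) \<inter> G\<close> are all disjoint from \<open>C\<close>, so
  that each step adds nearly \<open>|C|\<close> elements to \<open>V\<^sub>j \<subseteq> G\<close>. After more
  than \<open>2 / \<gamma>\<close> steps this exceeds \<open>|G|\<close>.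
\<close>

text \<open>Translations in a semigroup need not be injective. A point of \<open>G\<close> missed by
  \<open>f\<close> X\<open>comes from\<close>G - X\<open>, which covers at most\<close>card G - card
  X\<open>points, or lies outside\<close>f \<open>G\<close>.\<close>

lemma card_le_card_image_Int:
  assumes "finite G" "X \<subseteq> G"
  shows "card X \<le> card (f ` X \<inter> G) + card (sym_diff (f ` G) G)"
proof -
  have fin: "finite X" "finite (G - X)" "finite (f ` X \<inter> G)" "finite (sym_diff (f ` G) G)"
    using assms finite_subset by auto
  have "G \<subseteq> (f ` X \<inter> G) \<union> f ` (G - X) \<union> sym_diff (f ` G) G"
    by auto
  then have "card G \<le> card ((f ` X \<inter> G) \<union> f ` (G - X) \<union> sym_diff (f ` G) G)"
    using fin by (intro card_mono) auto
  also have "\<dots> \<le> card (f ` X \<inter> G) + card (f ` (G - X)) + card (sym_diff (f ` G) G)"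
    by (meson card_Un_le add_le_mono1 order_trans)
  also have "card (f ` (G - X)) \<le> card (G - X)"
    using fin by (intro card_image_le)
  also have "card (G - X) = card G - card X"
    using assms fin by (intro card_Diff_subset)
  finally show ?thesis
    using card_mono[OF assms] by linarith
qed

lemma card_Int_le_card_vimage:
  assumes "finite G"
  shows "card (A \<inter> G) \<le> card {x \<in> G. f x \<in> A} + card (sym_diff (f ` G) G)"
proof -
  have "A \<inter> G \<subseteq> f ` {x \<in> G. f x \<in> A} \<union> sym_diff (f ` G) G"
    by auto
  then have "card (A \<inter> G) \<le> card (f ` {x \<in> G. f x \<in> A} \<union> sym_diff (f ` G) G)"
    using assms by (intro card_mono) auto
  also have "\<dots> \<le> card (f ` {x \<in> G. f x \<in> A}) + card (sym_diff (f ` G) G)"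
    by (rule card_Un_le)
  also have "card (f ` {x \<in> G. f x \<in> A}) \<le> card {x \<in> G. f x \<in> A}"
    using assms by (intro card_image_le) auto
  finally show ?thesis by simp
qed

text \<open>\<open>T\<close> covers left and right translations at once. One sequence is fixed
  first, so \<alpha> depends on neither \<open>R\<close> nor \<epsilon>.\<close>

lemma dense_almost_invariant_sets:
  fixes T :: "'a \<Rightarrow> 'a \<Rightarrow> 'a"
  assumes "0 < Sup {limsup (\<lambda>n. ereal (real (card (C \<inter> F n)) / real (card (F n)))) | F.
    (\<forall>n. finite (F n) \<and> F n \<noteq> {}) \<and>
    (\<forall>s. (\<lambda>n. real (card (sym_diff (T s ` F n) (F n))) / real (card (F n))) \<longlonglongrightarrow> 0)}"
  shows "\<exists>\<alpha>>0. \<forall>R. \<forall>\<epsilon>::real. finite R \<longrightarrow> 0 < \<epsilon> \<longrightarrow>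
    (\<exists>G. finite G \<and> G \<noteq> {} \<and> \<alpha> * real (card G) \<le> card (C \<inter> G) \<and>
      (\<forall>r\<in>R. card (sym_diff (T r ` G) G) \<le> \<epsilon> * card G))"
proof -
  obtain F where fin: "\<And>n. finite (F n)" "\<And>n. F n \<noteq> {}"
    and inv: "\<And>s. (\<lambda>n. real (card (sym_diff (T s ` F n) (F n))) / real (card (F n))) \<longlonglongrightarrow> 0"
    and "0 < limsup (\<lambda>n. ereal (real (card (C \<inter> F n)) / real (card (F n))))"
    using assms unfolding less_Sup_iff by auto
  then obtain \<alpha> where "0 < \<alpha>"
    and \<alpha>: "ereal \<alpha> < limsup (\<lambda>n. ereal (real (card (C \<inter> F n)) / real (card (F n))))"
    using ereal_dense2 by fastforce
  have pos: "0 < real (card (F n))" for n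
    using fin by (simp add: card_gt_0_iff)
  \<comment> \<open>The limsup gives density only for infinitely many \<open>n\<close>, but almost
    invariance holds eventually, so some \<open>n\<close> has both.\<close>
  have freq: "\<exists>\<^sub>F n in sequentially. \<alpha> < real (card (C \<inter> F n)) / real (card (F n))"
  proof (rule ccontr)
    assume "\<not> ?thesis"
    then have "\<forall>\<^sub>F n in sequentially. ereal (real (card (C \<inter> F n)) / real (card (F n))) \<le> ereal \<alpha>"
      by (simp add: not_frequently not_less)
    then have "limsup (\<lambda>n. ereal (real (card (C \<inter> F n)) / real (card (F n)))) \<le> ereal \<alpha>"
      by (rule Limsup_bounded)
    with \<alpha> show False by simp
  qed
  have "\<exists>G. finite G \<and> G \<noteq> {} \<and> \<alpha> * real (card G) \<le> card (C \<inter> G) \<and>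
      (\<forall>r\<in>R. card (sym_diff (T r ` G) G) \<le> \<epsilon> * card G)"
    if "finite R" "0 < \<epsilon>" for R and \<epsilon> :: real
  proof -
    have "\<forall>\<^sub>F n in sequentially. \<forall>r\<in>R.
        real (card (sym_diff (T r ` F n) (F n))) / real (card (F n)) < \<epsilon>"
      using that by (intro eventually_ball_finite ballI order_tendstoD(2)[OF inv])
    then obtain n where "\<alpha> < real (card (C \<inter> F n)) / real (card (F n))"
      and "\<forall>r\<in>R. real (card (sym_diff (T r ` F n) (F n))) / real (card (F n)) < \<epsilon>"
      using frequently_ex[OF frequently_eventually_frequently[OF freq]] by blast
    then show ?thesis
      using fin pos[of n] by (intro exI[of _ "F n"]) (auto simp: field_simps intro: less_imp_le)
  qed
  with \<open>0 < \<alpha>\<close> show ?thesis by blast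
qed

lemma double_counting_ge:
  fixes c :: real
  assumes "finite F" "F \<noteq> {}" "finite H"
    and "\<And>x. x \<in> H \<Longrightarrow> c * card F \<le> card {t \<in> F. P t x}"
  shows "\<exists>t\<in>F. c * card H \<le> card {x \<in> H. P t x}"
proof (rule ccontr)
  assume "\<not> ?thesis"
  then have "(\<Sum>t\<in>F. real (card {x \<in> H. P t x})) < (\<Sum>t\<in>F. c * card H)"
    using assms by (intro sum_strict_mono) auto
  also have "\<dots> = (\<Sum>x\<in>H. c * card F)"
    by simp
  also have "\<dots> \<le> (\<Sum>x\<in>H. real (card {t \<in> F. P t x}))"
    using assms(4) by (rule sum_mono)
  also have "\<dots> = (\<Sum>x\<in>H. \<Sum>t\<in>F. of_bool (P t x))"
    using assms by (simp add: sum.If_cases of_bool_def Int_def)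
  also have "\<dots> = (\<Sum>t\<in>F. \<Sum>x\<in>H. of_bool (P t x))"
    by (rule sum.swap)
  also have "\<dots> = (\<Sum>t\<in>F. real (card {x \<in> H. P t x}))"
    using assms by (simp add: sum.If_cases of_bool_def Int_def)
  finally show False by simp
qed

text \<open>For each \<open>x\<close> in \<open>H\<close>, almost invariance under \<open>x\<close>
  costs at most \<alpha>/2, so \<open>t * x\<close> lies in \<open>A\<close> for a share \<alpha>/2
  of the \<open>t\<close> in \<open>F\<close>. Averaging over \<open>F\<close> yields one
  \<open>t\<close> for many \<open>x\<close>.\<close>

lemma dense_translate_pullback:
  fixes A H :: "'a::semigroup_mult set" and \<alpha> :: real
  assumes \<alpha>: "\<alpha> > 0" and H: "finite H"
    and F: "finite F" "F \<noteq> {}" "\<alpha> * card F \<le> card (A \<inter> F)"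
    and inv: "\<And>x. x \<in> H \<Longrightarrow> card (sym_diff ((\<lambda>t. t * x) ` F) F) \<le> \<alpha> / 2 * card F"
  shows "\<exists>t. \<alpha> / 2 * card H \<le> card {x \<in> H. t * x \<in> A}"
proof -
  have "\<alpha> / 2 * card F \<le> card {t \<in> F. t * x \<in> A}" if "x \<in> H" for x
  proof -
    have "real (card (A \<inter> F)) \<le>
        card {t \<in> F. t * x \<in> A} + card (sym_diff ((\<lambda>t. t * x) ` F) F)"
      using card_Int_le_card_vimage[OF F(1), of A "\<lambda>t. t * x"] by linarith
    then show ?thesis
      using F(3) inv[OF that] by (simp add: field_simps)
  qed
  then show ?thesis
    using double_counting_ge[OF F(1,2) H, of "\<alpha> / 2" "\<lambda>t x. t * x \<in> A"] by blast
qed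

theorem theorem3:
  fixes A B :: "'a::semigroup_mult set"
  assumes "\<exists>F :: nat \<Rightarrow> 'a set. left_Folner F"
    and "\<exists>F :: nat \<Rightarrow> 'a set. right_Folner F"
    and "right_upper_Banach_density A > 0"
    and "left_upper_Banach_density B > 0"
  shows "right_piecewise_syndetic (right_quotient A B)"
proof (rule ccontr)
  assume "\<not> ?thesis"
  then have "\<forall>K. \<exists>F. finite K \<longrightarrow> finite F \<and> (\<forall>t. \<exists>f\<in>F. \<forall>k\<in>K. \<forall>b\<in>B. t * f * k * b \<notin> A)"
    unfolding right_piecewise_syndetic_def right_quotient_def by (simp add: image_subset_iff)
  then obtain \<Phi> :: "'a set \<Rightarrow> 'a set"
    where \<Phi>_finite: "\<And>K. finite K \<Longrightarrow> finite (\<Phi> K)"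
      and \<Phi>: "\<And>K t. finite K \<Longrightarrow> \<exists>f\<in>\<Phi> K. \<forall>k\<in>K. \<forall>b\<in>B. t * f * k * b \<notin> A"
    by metis
  obtain \<alpha> :: real where \<alpha>: "\<alpha> > 0" and dense_A:
    "\<And>R (\<epsilon>::real). finite R \<Longrightarrow> \<epsilon> > 0 \<Longrightarrow> \<exists>G. finite G \<and> G \<noteq> {} \<and> \<alpha> * card G \<le> card (A \<inter> G) \<and>
       (\<forall>r\<in>R. card (sym_diff ((\<lambda>x. x * r) ` G) G) \<le> \<epsilon> * card G)"
    using dense_almost_invariant_sets[where T = "\<lambda>r x. x * r",
      OF assms(3)[unfolded right_upper_Banach_density_def right_Folner_def]] by blast
  obtain \<beta> :: real where \<beta>: "\<beta> > 0" and dense_B: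
    "\<And>R (\<epsilon>::real). finite R \<Longrightarrow> \<epsilon> > 0 \<Longrightarrow> \<exists>G. finite G \<and> G \<noteq> {} \<and> \<beta> * card G \<le> card (B \<inter> G) \<and>
       (\<forall>r\<in>R. card (sym_diff ((\<lambda>x. r * x) ` G) G) \<le> \<epsilon> * card G)"
    using dense_almost_invariant_sets[where T = "\<lambda>r x. r * x",
      OF assms(4)[unfolded left_upper_Banach_density_def left_Folner_def]] by blast
  define \<gamma> where "\<gamma> = \<alpha> / 2 * \<beta>"
  have \<gamma>: "\<gamma> > 0"
    using \<alpha> \<beta> by (simp add: \<gamma>_def)
  \<comment> \<open>Each step will gain \<gamma> and lose at most \<gamma>/2 as shares of
    \<open>G\<close>.\<close>
  obtain n :: nat where n: "1 < n * (\<gamma> / 2)"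
    using reals_Archimedean3[of "\<gamma> / 2"] \<gamma> half_gt_zero by blast
  \<comment> \<open>\<open>a\<close> stands in for an identity, which the semigroup may
    lack.\<close>
  obtain a :: 'a where True by blast
  define K where "K j = ((\<lambda>K. insert a ((\<lambda>(f, k). a * f * k) ` (\<Phi> K \<times> K))) ^^ j) {a}" for j :: nat
  have K_0: "K 0 = {a}"
    and K_Suc: "K (Suc j) = insert a ((\<lambda>(f, k). a * f * k) ` (\<Phi> (K j) \<times> K j))" for j
    by (simp_all add: K_def)
  have K_finite: "finite (K j)" for j
    by (induction j) (simp_all add: K_0 K_Suc \<Phi>_finite)
  have a_in_K: "a \<in> K j" for j
    by (cases j) (simp_all add: K_0 K_Suc)
  \<comment> \<open>The elements \<open>f\<close> depend on \<open>t\<close>, which is found only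
    after \<open>G\<close>. Hence \<open>G\<close> must be almost invariant under every candidate
    \<open>f * a\<close>.\<close>
  define R where "R = (\<Union>j<n. (\<lambda>f. f * a) ` \<Phi> (K j))"
  have "finite R"
    by (simp add: R_def \<Phi>_finite K_finite)
  then obtain G where G: "finite G" "G \<noteq> {}" "\<beta> * card G \<le> card (B \<inter> G)"
    and G_inv: "\<And>r. r \<in> R \<Longrightarrow> card (sym_diff ((\<lambda>x. r * x) ` G) G) \<le> \<gamma> / 2 * card G"
    using dense_B[of R "\<gamma> / 2"] \<gamma> by auto
  obtain F where "finite F" "F \<noteq> {}" "\<alpha> * card F \<le> card (A \<inter> F)"
    and "\<And>x. x \<in> B \<inter> G \<Longrightarrow> card (sym_diff ((\<lambda>t. t * x) ` F) F) \<le> \<alpha> / 2 * card F"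
    using dense_A[of "B \<inter> G" "\<alpha> / 2"] \<alpha> G by auto
  then obtain t where t: "\<alpha> / 2 * card (B \<inter> G) \<le> card {x \<in> B \<inter> G. t * x \<in> A}"
    using dense_translate_pullback[of \<alpha> "B \<inter> G" F A] \<alpha> G by auto
  define C where "C = {x \<in> B \<inter> G. t * x \<in> A}"
  have C_finite: "finite C" and C_subset: "C \<subseteq> G" and C_B: "C \<subseteq> B"
    using G by (auto simp: C_def)
  have "\<gamma> * card G \<le> \<alpha> / 2 * card (B \<inter> G)"
    using G(3) \<alpha> by (simp add: \<gamma>_def mult.assoc)
  with t have C_large: "\<gamma> * card G \<le> card C"
    by (simp add: C_def)
  \<comment> \<open>The clause \<open>a * v = k * c\<close> makes \<open>f * a * v\<close> equal to
    \<open>f * k * c\<close>, the form that the choice of \<open>f\<close> keeps out of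
    \<open>C\<close>.\<close>
  have "\<exists>V\<subseteq>G. V \<inter> C = {} \<and> (\<forall>v\<in>V. \<exists>k\<in>K j. \<exists>c\<in>C. a * v = k * c) \<and>
      j * (\<gamma> / 2) * card G \<le> card V" if "j \<le> n" for j
    using that
  proof (induction j)
    case 0
    then show ?case by (intro exI[of _ "{}"]) auto
  next
    case (Suc j)
    then obtain V where V: "V \<subseteq> G" "V \<inter> C = {}" "j * (\<gamma> / 2) * card G \<le> card V"
      and V_K: "\<And>v. v \<in> V \<Longrightarrow> \<exists>k\<in>K j. \<exists>c\<in>C. a * v = k * c"
      by auto
    obtain f where f: "f \<in> \<Phi> (K j)" and f_avoids: "\<And>k b. k \<in> K j \<Longrightarrow> b \<in> B \<Longrightarrow> t * f * k * b \<notin> A"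
      using \<Phi>[OF K_finite] by metis
    \<comment> \<open>\<open>V'\<close> need not contain \<open>V\<close>; only the cardinality has
      to grow.\<close>
    define V' where "V' = (\<lambda>x. f * a * x) ` (V \<union> C) \<inter> G"
    have V'_K: "\<exists>k\<in>K j. \<exists>c\<in>C. v = f * k * c" if v: "v \<in> V'" for v
    proof -
      obtain x where x: "x \<in> V \<union> C" "v = f * (a * x)"
        using v by (auto simp: V'_def mult.assoc)
      show ?thesis
      proof (cases "x \<in> C")
        case True
        then show ?thesis using x a_in_K by (metis mult.assoc)
      next
        case False
        then show ?thesis using x V_K by (metis UnE mult.assoc)
      qed
    qed
    have "V' \<inter> C = {}"
    proof (rule ccontr)
      assume "V' \<inter> C \<noteq> {}"
      then obtain k c where "k \<in> K j" "c \<in> C" "f * k * c \<in> C"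
        using V'_K by blast
      then show False
        \<comment> \<open>Membership of \<open>f * k * c\<close> in \<open>C\<close> would put
          \<open>t * f * k * c\<close> into \<open>A\<close>, although \<open>c\<close> is in
          \<open>B\<close>.\<close>
        using f_avoids[of k c] C_B by (auto simp: C_def mult.assoc)
    qed
    moreover have "\<exists>k\<in>K (Suc j). \<exists>c\<in>C. a * v = k * c" if v: "v \<in> V'" for v
    proof -
      obtain k c where "k \<in> K j" "c \<in> C" "v = f * k * c"
        using V'_K[OF v] by blast
      moreover from this have "a * f * k \<in> K (Suc j)"
        using f unfolding K_Suc by force
      ultimately show ?thesis
        by (metis mult.assoc)
    qed
    moreover have "Suc j * (\<gamma> / 2) * card G \<le> card V'"
    proof -
      have "f * a \<in> R"
        using f Suc.prems by (auto simp: R_def)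
      then have inv: "card (sym_diff ((\<lambda>x. f * a * x) ` G) G) \<le> \<gamma> / 2 * card G"
        by (rule G_inv)
      have "card V + card C = card (V \<union> C)"
        using V C_finite G(1) by (metis card_Un_disjoint finite_subset)
      also have "\<dots> \<le> card V' + card (sym_diff ((\<lambda>x. f * a * x) ` G) G)"
        unfolding V'_def using V C_subset G(1) by (intro card_le_card_image_Int) auto
      finally have "real (card V) + real (card C) \<le> card V' + \<gamma> / 2 * card G"
        using inv by linarith
      then show ?thesis
        using V(3) C_large by (simp add: algebra_simps)
    qed
    moreover have "V' \<subseteq> G"
      by (simp add: V'_def)
    ultimately show ?case
      by blast
  qed
  from this[of n] obtain V where V: "V \<subseteq> G" "n * (\<gamma> / 2) * card G \<le> card V"
    by auto
  have "card V \<le> card G"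
    using V G by (intro card_mono)
  moreover have "1 * real (card G) < n * (\<gamma> / 2) * card G"
    using G by (intro mult_strict_right_mono[OF n]) (simp add: card_gt_0_iff)
  ultimately show False
    using V(2) by linarith
qed

end
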